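(* Let $T$ and $S$ be commuting contractions of a Banach space $X$. If $F(T)\subset F(S)\neq X$, then there exist non-trivial double coboundaries of $T$ and $S$, i.e. $(I-T)(I-S)X\neq\{0\}$.
   Context: A contraction of a Banach space $X$ is a linear operator $T:X\to X$ with $\|T\|\le 1$. $F(T)=\{x\in X: Tx=x\}$ is the space of fixed points of $T$. For commuting contractions $T,S$, the elements of $(I-T)(I-S)X$ are called double coboundaries; non-trivial means non-zero. *)

theory Defs
  imports "HOL-Analysis.Analysis"
begin

text \<open>
  The Banach space is a type of class \<open>banach\<close>, with scalars \<open>real\<close>. This also covers complex
  Banach spaces: restricting the scalars changes neither the norm of a complex-linear operator
  nor its fixed points or its range.
\<close>

definition contraction :: "('a::real_normed_vector \<Rightarrow>\<^sub>L 'a) \<Rightarrow> bool" where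
  "contraction T \<longleftrightarrow> norm T \<le> 1"

definition fixed_space :: "('a::real_normed_vector \<Rightarrow>\<^sub>L 'a) \<Rightarrow> 'a set" where
  "fixed_space T = {x. blinfun_apply T x = x}"

definition double_coboundaries ::
    "('a::real_normed_vector \<Rightarrow>\<^sub>L 'a) \<Rightarrow> ('a \<Rightarrow>\<^sub>L 'a) \<Rightarrow> 'a set" where
  "double_coboundaries T S =
     range (blinfun_apply ((id_blinfun - T) o\<^sub>L (id_blinfun - S)))"

end

theory Submission
  imports Defs
begin

text \<open>
  If \<open>(I - T) (I - S) = 0\<close>, every \<open>y = x - S x\<close> is fixed by \<open>T\<close>, hence by \<open>S\<close>. Then the orbit
  \<open>S\<^sup>n x = x - n y\<close> is bounded only if \<open>y = 0\<close>.
\<close>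

lemma contraction_funpow_le:
  assumes "contraction S"
  shows "norm ((blinfun_apply S ^^ n) x) \<le> norm x"
proof (induction n)
  case (Suc n)
  have "norm S * norm ((blinfun_apply S ^^ n) x) \<le> 1 * norm ((blinfun_apply S ^^ n) x)"
    using assms by (intro mult_right_mono) (auto simp: contraction_def)
  with Suc norm_blinfun[of S "(blinfun_apply S ^^ n) x"] show ?case
    by simp
qed simp

text \<open>A fixed coboundary makes the orbit of \<open>x\<close> drift by the same vector at every
  step, while the iterates of a contraction stay bounded. In operator terms, the kernel and the
  range of \<open>I - S\<close> meet only in 0.\<close>

lemma contraction_fixed_coboundary_zero:
  fixes S :: "'a::real_normed_vector \<Rightarrow>\<^sub>L 'a"
  assumes S: "contraction S" and fixed: "x - blinfun_apply S x \<in> fixed_space S"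
  shows "x - blinfun_apply S x = 0"
proof -
  define y where "y = x - blinfun_apply S x"
  have Sx: "blinfun_apply S x = x - y" and Sy: "blinfun_apply S y = y"
    using fixed by (simp_all add: y_def fixed_space_def)
  \<comment> \<open>Since \<open>S\<close> fixes \<open>y\<close>, it leaves the accumulated term
    \<open>n y\<close> unchanged and sends \<open>x\<close> to \<open>x - y\<close>, so each
    application subtracts exactly one more \<open>y\<close>.\<close>
  have orbit: "(blinfun_apply S ^^ n) x = x - of_nat n *\<^sub>R y" for n
    by (induction n) (simp_all add: blinfun.diff_right blinfun.scaleR_right Sx Sy scaleR_add_left)
  \<comment> \<open>The right-hand side is independent of \<open>n\<close>, so the Archimedean
    property will force \<open>norm y\<close> to vanish.\<close>
  have bound: "of_nat n * norm y \<le> 2 * norm x" for n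
  proof -
    have "of_nat n * norm y = norm (x - (blinfun_apply S ^^ n) x)"
      by (simp add: orbit)
    also have "\<dots> \<le> norm x + norm ((blinfun_apply S ^^ n) x)"
      by (rule norm_triangle_ineq4)
    also have "\<dots> \<le> 2 * norm x"
      using contraction_funpow_le[OF S, of n x] by simp
    finally show ?thesis .
  qed
  have "norm y \<le> 0"
  proof (rule ccontr)
    assume "\<not> norm y \<le> 0"
    then obtain n where "2 * norm x < of_nat n * norm y"
      using reals_Archimedean3[of "norm y"] by auto
    with bound[of n] show False
      by simp
  qed
  then show ?thesis
    by (simp add: y_def)
qed

theorem theorem2p4:
  fixes T S :: "'a::banach \<Rightarrow>\<^sub>L 'a"
  assumes "contraction T" and "contraction S"
    and "T o\<^sub>L S = S o\<^sub>L T"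
    and "fixed_space T \<subseteq> fixed_space S"
    and "fixed_space S \<noteq> UNIV"
  shows "double_coboundaries T S \<noteq> {0}"
proof
  assume "double_coboundaries T S = {0}"
  then have zero: "blinfun_apply ((id_blinfun - T) o\<^sub>L (id_blinfun - S)) x = 0" for x
    unfolding double_coboundaries_def by blast
  have "x \<in> fixed_space S" for x
  proof -
    \<comment> \<open>The vanishing double coboundary of \<open>x\<close> says that
      \<open>I - T\<close> kills \<open>x - S x\<close>. The inclusion of fixed spaces then makes
      this vector a coboundary of \<open>S\<close> that \<open>S\<close> itself fixes.\<close>
    have "x - blinfun_apply S x \<in> fixed_space T"
      using zero[of x] by (simp add: fixed_space_def blinfun.diff_left)
    then have "x - blinfun_apply S x = 0"
      using assms(2,4) contraction_fixed_coboundary_zero by blast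
    then show ?thesis
      by (simp add: fixed_space_def)
  qed
  with assms(5) show False
    by blast
qed

end
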